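(* Let $\mathcal X=\{x_1,\dots,x_n\}$ be a finite state space, and let $\pi$ (target) and $p$ (proposal) be probability mass functions on $\mathcal X$ with $\pi(x_i)>0$ and $p(x_i)>0$ for all $i$. Let $w=\pi/p$ and $w^\star=\max_{i}w(x_i)$, and let $P$ be the transition kernel of the Independent Metropolis-Hastings (IMH) chain with target $\pi$ and proposal $p$. Then for every $x\in\mathcal X$ the limit $r(x)=\lim_{t\to\infty}\|P^t(x,\cdot)-\pi\|_{\mathrm{TV}}^{1/t}$ exists and $$r(x)=\liminf_{t\to\infty}\|P^t(x,\cdot)-\pi\|_{\mathrm{TV}}^{1/t}=\limsup_{t\to\infty}\|P^t(x,\cdot)-\pi\|_{\mathrm{TV}}^{1/t}=1-\frac1{w^\star}.$$
   Context: The IMH chain has transition probabilities $$P(x_i,x_j)=\begin{cases}p(x_j)\min\{1,\frac{w(x_j)}{w(x_i)}\}, & j\ne i,\\[2pt] p(x_i)+\sum_k p(x_k)\max\{0,1-\frac{w(x_k)}{w(x_i)}\}, & j=i.\end{cases}$$ $P^t$ is the $t$-step kernel, and $\|\mu-\nu\|_{\mathrm{TV}}=\max_{A\subset\mathcal X}|\mu(A)-\nu(A)|$. *)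

theory Defs
  imports "HOL-Probability.Probability"
begin

definition imh_weight :: "'a pmf \<Rightarrow> 'a pmf \<Rightarrow> 'a \<Rightarrow> real" where
  "imh_weight \<pi> p x = pmf \<pi> x / pmf p x"

definition imh_max_weight :: "'a::finite pmf \<Rightarrow> 'a pmf \<Rightarrow> real" where
  "imh_max_weight \<pi> p = (MAX x. imh_weight \<pi> p x)"

definition imh_prob :: "'a::finite pmf \<Rightarrow> 'a pmf \<Rightarrow> 'a \<Rightarrow> 'a \<Rightarrow> real" where
  "imh_prob \<pi> p x y =
     (if y \<noteq> x then pmf p y * min 1 (imh_weight \<pi> p y / imh_weight \<pi> p x)
      else pmf p x + (\<Sum>z\<in>UNIV. pmf p z * max 0 (1 - imh_weight \<pi> p z / imh_weight \<pi> p x)))"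

text \<open>When \<open>\<pi>\<close> and \<open>p\<close> have full support the entries \<^const>\<open>imh_prob\<close> are stochastic, so
  \<^const>\<open>embed_pmf\<close> is meaningful below; see \<open>pmf_imh_kernel\<close>.\<close>

definition imh_kernel :: "'a::finite pmf \<Rightarrow> 'a pmf \<Rightarrow> 'a \<Rightarrow> 'a pmf" where
  "imh_kernel \<pi> p x = embed_pmf (imh_prob \<pi> p x)"

primrec kernel_power :: "('a \<Rightarrow> 'a pmf) \<Rightarrow> nat \<Rightarrow> 'a \<Rightarrow> 'a pmf" where
  "kernel_power K 0 x = return_pmf x"
| "kernel_power K (Suc t) x = bind_pmf (K x) (kernel_power K t)"

definition tv_dist :: "'a::finite pmf \<Rightarrow> 'a pmf \<Rightarrow> real" where
  "tv_dist \<mu> \<nu> = (MAX A. \<bar>measure_pmf.prob \<mu> A - measure_pmf.prob \<nu> A\<bar>)"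

definition imh_tv_root :: "'a::finite pmf \<Rightarrow> 'a pmf \<Rightarrow> 'a \<Rightarrow> nat \<Rightarrow> real" where
  "imh_tv_root \<pi> p x t = tv_dist (kernel_power (imh_kernel \<pi> p) t x) \<pi> powr (1 / real t)"

lemma imh_prob_nonneg: "imh_prob \<pi> p x y \<ge> 0"
  unfolding imh_prob_def imh_weight_def
  by (auto intro!: mult_nonneg_nonneg add_nonneg_nonneg sum_nonneg)

lemma sum_imh_prob:
  fixes \<pi> p :: "'a::finite pmf"
  assumes "\<And>x. pmf \<pi> x > 0" "\<And>x. pmf p x > 0"
  shows "(\<Sum>y\<in>UNIV. imh_prob \<pi> p x y) = 1"
proof -
  let ?q = "\<lambda>z. imh_weight \<pi> p z / imh_weight \<pi> p x"
  have q: "imh_weight \<pi> p x \<noteq> 0"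
    using assms[of x] by (simp add: imh_weight_def)
  have s: "sum f UNIV = f x + sum f (UNIV - {x})" for f :: "'a \<Rightarrow> real"
    by (simp add: sum.remove)
  have "(\<Sum>y\<in>UNIV. imh_prob \<pi> p x y)
      = pmf p x + (\<Sum>z\<in>UNIV. pmf p z * max 0 (1 - ?q z))
        + (\<Sum>y\<in>UNIV - {x}. pmf p y * min 1 (?q y))"
    by (subst s) (simp add: imh_prob_def)
  also have "\<dots> = pmf p x + (\<Sum>z\<in>UNIV - {x}. pmf p z * max 0 (1 - ?q z) + pmf p z * min 1 (?q z))"
    by (subst s) (simp add: q sum.distrib)
  also have "\<dots> = pmf p x + (\<Sum>z\<in>UNIV - {x}. pmf p z)"
    by (intro arg_cong2[of _ _ _ _ "(+)"] sum.cong refl)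
       (simp add: max_def min_def algebra_simps)
  also have "\<dots> = 1"
    by (simp flip: s add: sum_pmf_eq_1)
  finally show ?thesis .
qed

lemma pmf_imh_kernel:
  fixes \<pi> p :: "'a::finite pmf"
  assumes "\<And>x. pmf \<pi> x > 0" "\<And>x. pmf p x > 0"
  shows "pmf (imh_kernel \<pi> p x) y = imh_prob \<pi> p x y"
  unfolding imh_kernel_def
proof (rule pmf_embed_pmf)
  show "(\<integral>\<^sup>+ y. ennreal (imh_prob \<pi> p x y) \<partial>count_space UNIV) = 1"
    by (simp add: nn_integral_count_space_finite sum_ennreal imh_prob_nonneg sum_imh_prob assms)
qed (rule imh_prob_nonneg)

end

theory Submission
  imports Defs
begin

text \<open>
  Write \<open>\<rho> = 1 - 1 / w\<^sup>\<star>\<close>. Every row of the kernel dominates \<open>\<pi> / w\<^sup>\<star>\<close>, so Doeblin's argument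
  bounds the distance to \<open>\<pi>\<close> after \<open>t\<close> steps by \<open>\<rho> ^ t\<close>. Conversely, if \<open>m\<close> is a state of maximal
  weight, then the centred indicator of \<open>m\<close> is an eigenfunction of the kernel with eigenvalue \<open>\<rho>\<close>,
  so that the probability of being at \<open>m\<close> differs from \<open>\<pi> m\<close> by exactly a constant times \<open>\<rho> ^ t\<close>;
  this constant is nonzero for every starting state unless \<open>\<rho> = 0\<close>.
\<close>

section \<open>Total variation and Doeblin's bound for kernels on a finite space\<close>

lemma prob_bind_pmf_finite:
  fixes M :: "'a::finite pmf" and K :: "'a \<Rightarrow> 'b::finite pmf"
  shows "measure_pmf.prob (bind_pmf M K) A = (\<Sum>y\<in>UNIV. pmf M y * measure_pmf.prob (K y) A)"
proof -
  have "measure_pmf.prob (bind_pmf M K) A = (\<Sum>z\<in>A. \<Sum>y\<in>UNIV. pmf M y * pmf (K y) z)"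
    by (simp add: measure_measure_pmf_finite pmf_bind integral_measure_pmf[of UNIV])
  also have "\<dots> = (\<Sum>y\<in>UNIV. \<Sum>z\<in>A. pmf M y * pmf (K y) z)"
    by (rule sum.swap)
  also have "\<dots> = (\<Sum>y\<in>UNIV. pmf M y * measure_pmf.prob (K y) A)"
    by (simp add: measure_measure_pmf_finite sum_distrib_left)
  finally show ?thesis .
qed

lemma tv_dist_le_iff:
  "tv_dist \<mu> \<nu> \<le> c \<longleftrightarrow> (\<forall>A. \<bar>measure_pmf.prob \<mu> A - measure_pmf.prob \<nu> A\<bar> \<le> c)"
  unfolding tv_dist_def by (subst Max_le_iff) auto

lemma abs_prob_diff_le_tv_dist: "\<bar>measure_pmf.prob \<mu> A - measure_pmf.prob \<nu> A\<bar> \<le> tv_dist \<mu> \<nu>"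
  using tv_dist_le_iff by blast

lemma abs_pmf_diff_le_tv_dist: "\<bar>pmf \<mu> y - pmf \<nu> y\<bar> \<le> tv_dist \<mu> \<nu>"
  using abs_prob_diff_le_tv_dist[of \<mu> "{y}" \<nu>] by (simp add: measure_pmf_single)

lemma tv_dist_nonneg: "tv_dist \<mu> \<nu> \<ge> 0"
  using abs_prob_diff_le_tv_dist[of \<mu> "{}" \<nu>] by simp

text \<open>\<open>kernel_power\<close> adds steps at the front, so associativity of bind lets
  \<open>\<pi>\<close> absorb them one at a time.\<close>

lemma bind_kernel_power_stationary:
  assumes "bind_pmf \<pi> K = \<pi>"
  shows "bind_pmf \<pi> (kernel_power K t) = \<pi>"
proof (induction t)
  case (Suc t)
  then show ?case
    using assms by (simp flip: bind_assoc_pmf)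
qed (simp add: bind_return_pmf')

text \<open>Stationarity makes the error of a fixed event average to 0 under \<open>\<pi>\<close>,
  so \<open>\<epsilon> * pmf \<pi> y\<close> can be subtracted from each row without changing the
  recursion for the error. The remaining weights are nonnegative with total mass
  \<open>1 - \<epsilon>\<close>, and one step contracts a uniform error bound by that
  factor.\<close>

lemma doeblin_tv_dist_le:
  fixes K :: "'a::finite \<Rightarrow> 'a pmf"
  assumes stationary: "bind_pmf \<pi> K = \<pi>"
    and minor: "\<And>x y. \<epsilon> * pmf \<pi> y \<le> pmf (K x) y"
  shows "tv_dist (kernel_power K t x) \<pi> \<le> (1 - \<epsilon>) ^ t"
  unfolding tv_dist_le_iff
proof
  fix A
  define h where
    "h t x = measure_pmf.prob (kernel_power K t x) A - measure_pmf.prob \<pi> A" for t x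
  have mean: "(\<Sum>y\<in>UNIV. pmf \<pi> y * h t y) = 0" for t
  proof -
    have "(\<Sum>y\<in>UNIV. pmf \<pi> y * h t y)
        = measure_pmf.prob (bind_pmf \<pi> (kernel_power K t)) A - measure_pmf.prob \<pi> A"
      by (simp add: h_def prob_bind_pmf_finite right_diff_distrib sum_subtractf sum_pmf_eq_1
          flip: sum_distrib_right)
    then show ?thesis
      by (simp add: bind_kernel_power_stationary stationary)
  qed
  have "\<bar>h t x\<bar> \<le> (1 - \<epsilon>) ^ t"
  proof (induction t arbitrary: x)
    case 0
    have "0 \<le> measure_pmf.prob \<mu> A" "measure_pmf.prob \<mu> A \<le> 1" for \<mu> :: "'a pmf"
      by simp_all
    then show ?case
      unfolding h_def by (smt (verit) power_0)
  next
    case (Suc t)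
    have "h (Suc t) x = (\<Sum>y\<in>UNIV. pmf (K x) y * h t y)"
      by (simp add: h_def prob_bind_pmf_finite right_diff_distrib sum_subtractf sum_pmf_eq_1
          flip: sum_distrib_right)
    also have "\<dots> = (\<Sum>y\<in>UNIV. (pmf (K x) y - \<epsilon> * pmf \<pi> y) * h t y)"
      using mean[of t]
      by (simp add: left_diff_distrib sum_subtractf mult.assoc flip: sum_distrib_left)
    finally have "\<bar>h (Suc t) x\<bar> \<le> (\<Sum>y\<in>UNIV. (pmf (K x) y - \<epsilon> * pmf \<pi> y) * \<bar>h t y\<bar>)"
      using minor by (auto intro!: order.trans[OF sum_abs] sum_mono simp: abs_mult)
    also have "\<dots> \<le> (\<Sum>y\<in>UNIV. (pmf (K x) y - \<epsilon> * pmf \<pi> y) * (1 - \<epsilon>) ^ t)"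
      using minor Suc by (auto intro!: sum_mono mult_left_mono)
    also have "\<dots> = (1 - \<epsilon>) ^ Suc t"
      by (simp add: sum_subtractf sum_pmf_eq_1 flip: sum_distrib_right sum_distrib_left)
    finally show ?case .
  qed
  then show "\<bar>measure_pmf.prob (kernel_power K t x) A - measure_pmf.prob \<pi> A\<bar> \<le> (1 - \<epsilon>) ^ t"
    by (simp add: h_def)
qed

text \<open>The constant \<open>c\<close> disappears because \<open>c powr (1 / real t)\<close>
  tends to 1.\<close>

lemma tendsto_powr_root_sandwich:
  fixes f :: "nat \<Rightarrow> real"
  assumes c: "c > 0" and \<rho>: "\<rho> \<ge> 0"
    and lower: "\<And>t. c * \<rho> ^ t \<le> f t" and upper: "\<And>t. f t \<le> \<rho> ^ t"
  shows "(\<lambda>t. f t powr (1 / real t)) \<longlonglongrightarrow> \<rho>"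
proof (rule tendsto_sandwich)
  \<comment> \<open>At \<open>t = 0\<close> the exponent \<open>1 / real t\<close> is 0 and the left
    side is 1. The case \<open>\<rho> = 0\<close> is split off because \<open>powr_realpow\<close>
    wants a positive base.\<close>
  have root: "(\<rho> ^ t) powr (1 / real t) = \<rho>" if "t > 0" for t
    using that \<rho> by (cases "\<rho> = 0") (simp_all add: powr_powr flip: powr_realpow)
  have nonneg: "0 \<le> f t" for t
    using lower[of t] c \<rho> by (smt (verit) mult_nonneg_nonneg zero_le_power)
  have "c powr (1 / real t) * \<rho> \<le> f t powr (1 / real t)" if "t > 0" for t
  proof -
    have "c powr (1 / real t) * \<rho> = (c * \<rho> ^ t) powr (1 / real t)"
      using that c \<rho> by (simp add: powr_mult root)
    also have "\<dots> \<le> f t powr (1 / real t)"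
      using lower c \<rho> by (intro powr_mono2) auto
    finally show ?thesis .
  qed
  then show "\<forall>\<^sub>F t in sequentially. c powr (1 / real t) * \<rho> \<le> f t powr (1 / real t)"
    using eventually_gt_at_top[of 0] by (rule eventually_mono[rotated])
  have "f t powr (1 / real t) \<le> \<rho>" if "t > 0" for t
    using powr_mono2[OF _ nonneg upper, of "1 / real t" t] by (simp add: root that)
  then show "\<forall>\<^sub>F t in sequentially. f t powr (1 / real t) \<le> \<rho>"
    using eventually_gt_at_top[of 0] by (rule eventually_mono[rotated])
  have "(\<lambda>t. c powr (1 / real t) * \<rho>) \<longlonglongrightarrow> c powr 0 * \<rho>"
    using c by (intro tendsto_intros lim_1_over_n) auto
  then show "(\<lambda>t. c powr (1 / real t) * \<rho>) \<longlonglongrightarrow> \<rho>"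
    using c by simp
qed simp

section \<open>The IMH kernel: weights, minorization and reversibility\<close>

context
  fixes \<pi> p :: "'a::finite pmf"
  assumes pos_target: "\<And>y. pmf \<pi> y > 0" and pos_proposal: "\<And>y. pmf p y > 0"
begin

lemma imh_weight_pos: "imh_weight \<pi> p x > 0"
  using pos_target pos_proposal by (simp add: imh_weight_def)

lemma imh_weight_le_max: "imh_weight \<pi> p x \<le> imh_max_weight \<pi> p"
  unfolding imh_max_weight_def by (rule Max_ge) auto

lemma imh_max_weight_pos: "imh_max_weight \<pi> p > 0"
  using imh_weight_pos imh_weight_le_max less_le_trans by blast

lemma imh_max_weight_attained: obtains m where "imh_weight \<pi> p m = imh_max_weight \<pi> p"
proof -
  have "imh_max_weight \<pi> p \<in> range (imh_weight \<pi> p)"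
    unfolding imh_max_weight_def by (rule Max_in) auto
  then show ?thesis
    using that by auto
qed

text \<open>In this form the denominator is symmetric in the two states, which gives detailed
  balance, and at most the maximal weight, which gives the minorization.\<close>

lemma pmf_imh_kernel_off_diagonal:
  assumes "y \<noteq> x"
  shows "pmf (imh_kernel \<pi> p x) y = pmf \<pi> y / max (imh_weight \<pi> p x) (imh_weight \<pi> p y)"
proof -
  have \<pi>_y: "pmf \<pi> y = pmf p y * imh_weight \<pi> p y"
    using pos_proposal[of y] by (simp add: imh_weight_def)
  have *: "pmf (imh_kernel \<pi> p x) y = pmf p y * min 1 (imh_weight \<pi> p y / imh_weight \<pi> p x)"
    using assms by (simp add: pmf_imh_kernel[OF pos_target pos_proposal] imh_prob_def)
  show ?thesis
  proof (cases "imh_weight \<pi> p y \<le> imh_weight \<pi> p x")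
    case True
    then show ?thesis
      unfolding * \<pi>_y using imh_weight_pos[of x] by (simp add: min_def max_def)
  next
    case False
    then show ?thesis
      unfolding * \<pi>_y using imh_weight_pos[of x] imh_weight_pos[of y]
      by (simp add: min_def max_def)
  qed
qed

text \<open>Off the diagonal, the larger of the two weights is at most the maximum. On it, proposing
  \<open>x\<close> itself already contributes \<open>pmf p x\<close>, which is
  \<open>pmf \<pi> x\<close> divided by the weight of \<open>x\<close>; rejections only add
  mass.\<close>

lemma imh_kernel_minorized:
  "1 / imh_max_weight \<pi> p * pmf \<pi> y \<le> pmf (imh_kernel \<pi> p x) y"
proof -
  let ?W = "imh_max_weight \<pi> p"
  have "pmf \<pi> y / ?W \<le> pmf \<pi> y / max (imh_weight \<pi> p x) (imh_weight \<pi> p y)"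
    using pos_target[of y] imh_weight_pos[of x] imh_weight_le_max
    by (intro divide_left_mono) (auto simp: imh_max_weight_pos less_max_iff_disj)
  moreover have "pmf \<pi> x / ?W \<le> pmf p x"
    using imh_weight_le_max[of x] imh_max_weight_pos pos_proposal[of x]
    by (simp add: imh_weight_def field_simps)
  moreover have "pmf p x \<le> pmf (imh_kernel \<pi> p x) x"
    by (simp add: pmf_imh_kernel[OF pos_target pos_proposal] imh_prob_def sum_nonneg)
  ultimately show ?thesis
    by (cases "y = x") (simp_all add: pmf_imh_kernel_off_diagonal)
qed

text \<open>Summing the minorization over a single row compares the total masses
  \<open>1 / imh_max_weight \<pi> p\<close> and 1.\<close>

lemma imh_max_weight_ge_1: "imh_max_weight \<pi> p \<ge> 1"
proof -
  fix x :: 'a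
  have "(\<Sum>y\<in>UNIV. 1 / imh_max_weight \<pi> p * pmf \<pi> y) \<le> (\<Sum>y\<in>UNIV. pmf (imh_kernel \<pi> p x) y)"
    by (intro sum_mono imh_kernel_minorized)
  then show ?thesis
    using imh_max_weight_pos by (simp add: sum_pmf_eq_1 flip: sum_distrib_left sum_divide_distrib)
qed

lemma imh_kernel_reversible:
  "pmf \<pi> x * pmf (imh_kernel \<pi> p x) y = pmf \<pi> y * pmf (imh_kernel \<pi> p y) x"
  by (cases "x = y") (simp_all add: pmf_imh_kernel_off_diagonal max.commute)

lemma imh_kernel_stationary: "bind_pmf \<pi> (imh_kernel \<pi> p) = \<pi>"
proof (rule pmf_eqI)
  fix y
  have "pmf (bind_pmf \<pi> (imh_kernel \<pi> p)) y = (\<Sum>x\<in>UNIV. pmf \<pi> x * pmf (imh_kernel \<pi> p x) y)"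
    by (simp add: pmf_bind integral_measure_pmf[of UNIV])
  also have "\<dots> = (\<Sum>x\<in>UNIV. pmf \<pi> y * pmf (imh_kernel \<pi> p y) x)"
    by (simp add: imh_kernel_reversible)
  finally show "pmf (bind_pmf \<pi> (imh_kernel \<pi> p)) y = pmf \<pi> y"
    by (simp add: sum_pmf_eq_1 flip: sum_distrib_left)
qed

section \<open>The eigenfunction at a state of maximal weight\<close>

lemma pmf_imh_kernel_max_weight:
  assumes m: "imh_weight \<pi> p m = imh_max_weight \<pi> p"
  shows "pmf (imh_kernel \<pi> p x) m - pmf \<pi> m
    = (1 - 1 / imh_max_weight \<pi> p) * (of_bool (x = m) - pmf \<pi> m)"
proof -
  let ?W = "imh_max_weight \<pi> p"
  have mx: "max (imh_weight \<pi> p z) ?W = ?W" "max ?W (imh_weight \<pi> p z) = ?W" for z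
    using imh_weight_le_max[of z] by auto
  show ?thesis
  proof (cases "x = m")
    case True
    have *: "sum (pmf \<mu>) (UNIV - {m}) = 1 - pmf \<mu> m" for \<mu>
      using sum.remove[of UNIV m "pmf \<mu>"] by (simp add: sum_pmf_eq_1)
    \<comment> \<open>The holding probability at \<open>m\<close> is computed from the exits: since
      \<open>m\<close> has maximal weight, all of them have the same denominator
      \<open>?W\<close>.\<close>
    have "1 - pmf (imh_kernel \<pi> p m) m = (\<Sum>y\<in>UNIV - {m}. pmf \<pi> y / ?W)"
      unfolding *[symmetric] by (intro sum.cong) (auto simp: pmf_imh_kernel_off_diagonal m mx)
    also have "\<dots> = (1 - pmf \<pi> m) / ?W"
      by (simp add: * flip: sum_divide_distrib)
    finally show ?thesis
      using True by (simp add: algebra_simps diff_divide_distrib)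
  next
    case False
    then show ?thesis
      by (simp add: pmf_imh_kernel_off_diagonal m mx algebra_simps)
  qed
qed

lemma pmf_imh_kernel_power_max_weight:
  assumes m: "imh_weight \<pi> p m = imh_max_weight \<pi> p"
  shows "pmf (kernel_power (imh_kernel \<pi> p) t x) m - pmf \<pi> m
    = (1 - 1 / imh_max_weight \<pi> p) ^ t * (of_bool (x = m) - pmf \<pi> m)"
proof (induction t arbitrary: x)
  case 0
  then show ?case by (simp add: indicator_def)
next
  case (Suc t)
  let ?K = "imh_kernel \<pi> p" and ?\<rho> = "1 - 1 / imh_max_weight \<pi> p"
  have "pmf (kernel_power ?K (Suc t) x) m - pmf \<pi> m
      = (\<Sum>y\<in>UNIV. pmf (?K x) y * (pmf (kernel_power ?K t y) m - pmf \<pi> m))"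
    by (simp add: pmf_bind integral_measure_pmf[of UNIV] right_diff_distrib sum_subtractf
        sum_pmf_eq_1 flip: sum_distrib_right)
  \<comment> \<open>What remains after factoring out \<open>?\<rho> ^ t\<close> is the kernel
    applied once to the centred indicator, which yields one more factor
    \<open>?\<rho>\<close>.\<close>
  also have "\<dots> = ?\<rho> ^ t * (\<Sum>y\<in>UNIV. pmf (?K x) y * (of_bool (y = m) - pmf \<pi> m))"
    unfolding Suc by (simp add: sum_distrib_left mult.left_commute)
  also have "(\<Sum>y\<in>UNIV. pmf (?K x) y * (of_bool (y = m) - pmf \<pi> m)) = pmf (?K x) m - pmf \<pi> m"
    by (simp add: right_diff_distrib sum_subtractf sum_pmf_eq_1 flip: sum_distrib_right)
  finally show ?case
    by (simp add: pmf_imh_kernel_max_weight[OF m])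
qed

text \<open>A state of full mass would, by positivity of \<open>\<pi>\<close>, be the only state;
  then both mass functions are 1 there and the maximal weight is 1.\<close>

lemma pmf_lt_1_if_imh_max_weight_gt_1:
  assumes "imh_max_weight \<pi> p > 1"
  shows "pmf \<pi> y < 1"
proof (rule ccontr)
  assume "\<not> pmf \<pi> y < 1"
  then have "pmf \<pi> y = 1"
    using pmf_le_1[of \<pi> y] by linarith
  then have "(\<Sum>z\<in>UNIV - {y}. pmf \<pi> z) = 0"
    using sum.remove[of UNIV y "pmf \<pi>"] by (simp add: sum_pmf_eq_1)
  then have single: "UNIV - {y} = {}"
    using pos_target sum_pos[of "UNIV - {y}" "pmf \<pi>"] by fastforce
  have *: "pmf \<mu> y = 1" for \<mu>
    using sum.remove[of UNIV y "pmf \<mu>"] unfolding single by (simp add: sum_pmf_eq_1)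
  obtain m where m: "imh_weight \<pi> p m = imh_max_weight \<pi> p"
    by (rule imh_max_weight_attained)
  moreover have "m = y"
    using single by blast
  ultimately show False
    using assms by (simp add: imh_weight_def *)
qed

section \<open>The limit of the roots\<close>

lemma imh_tv_root_tendsto: "imh_tv_root \<pi> p x \<longlonglongrightarrow> 1 - 1 / imh_max_weight \<pi> p"
proof -
  let ?\<rho> = "1 - 1 / imh_max_weight \<pi> p"
  obtain m where m: "imh_weight \<pi> p m = imh_max_weight \<pi> p"
    by (rule imh_max_weight_attained)
  let ?d = "\<lambda>t. tv_dist (kernel_power (imh_kernel \<pi> p) t x) \<pi>"
  \<comment> \<open>The size of the eigenfunction at the start \<open>x\<close>:
    \<open>1 - pmf \<pi> m\<close> if \<open>x = m\<close>, and \<open>pmf \<pi> m\<close>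
    otherwise.\<close>
  let ?c = "\<bar>of_bool (x = m) - pmf \<pi> m\<bar>"
  have \<rho>: "?\<rho> \<ge> 0"
    using imh_max_weight_ge_1 by simp
  have upper: "?d t \<le> ?\<rho> ^ t" for t
    by (intro doeblin_tv_dist_le imh_kernel_stationary imh_kernel_minorized)
  have lower: "?c * ?\<rho> ^ t \<le> ?d t" for t
    using abs_pmf_diff_le_tv_dist[of "kernel_power (imh_kernel \<pi> p) t x" m \<pi>] \<rho>
    by (simp add: pmf_imh_kernel_power_max_weight[OF m] abs_mult mult.commute)
  show ?thesis
  proof (cases "imh_max_weight \<pi> p = 1")
    \<comment> \<open>Here \<open>?\<rho> = 0\<close>, and \<open>?c\<close> vanishes if there is
      only one state, so the sandwich is avoided: the upper bound alone forces distance 0 for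
      \<open>t > 0\<close>, while at \<open>t = 0\<close> it reads \<open>0 ^ 0 = 1\<close>.\<close>
    case True
    then have "imh_tv_root \<pi> p x t = 0" if "t > 0" for t
      using upper[of t] tv_dist_nonneg[of "kernel_power (imh_kernel \<pi> p) t x" \<pi>] that
      by (simp add: imh_tv_root_def zero_power)
    then have "\<forall>\<^sub>F t in sequentially. imh_tv_root \<pi> p x t = 0"
      using eventually_gt_at_top[of 0] by (rule eventually_mono[rotated])
    then show ?thesis
      using True by (simp add: tendsto_eventually)
  next
    case False
    then have "pmf \<pi> m < 1"
      using imh_max_weight_ge_1 by (intro pmf_lt_1_if_imh_max_weight_gt_1) simp
    then have "?c > 0"
      using pos_target[of m] by (cases "x = m") auto
    from tendsto_powr_root_sandwich[OF this \<rho> lower upper] show ?thesis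
      by (simp add: imh_tv_root_def[abs_def])
  qed
qed

end

theorem theorem6:
  fixes \<pi> p :: "'a::finite pmf" and x :: 'a
  assumes "\<And>y. pmf \<pi> y > 0" and "\<And>y. pmf p y > 0"
  shows "convergent (imh_tv_root \<pi> p x)
    \<and> ereal (lim (imh_tv_root \<pi> p x)) = liminf (\<lambda>t. ereal (imh_tv_root \<pi> p x t))
    \<and> ereal (lim (imh_tv_root \<pi> p x)) = limsup (\<lambda>t. ereal (imh_tv_root \<pi> p x t))
    \<and> lim (imh_tv_root \<pi> p x) = 1 - 1 / imh_max_weight \<pi> p"
proof -
  note lim = imh_tv_root_tendsto[OF assms, of x]
  \<comment> \<open>The lower and upper limits are taken in the extended reals, so the convergence
    is transferred there.\<close>
  then have ereal_lim:
    "(\<lambda>t. ereal (imh_tv_root \<pi> p x t)) \<longlonglongrightarrow> ereal (1 - 1 / imh_max_weight \<pi> p)"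
    by simp
  show ?thesis
    using lim lim_imp_Liminf[OF sequentially_bot ereal_lim] lim_imp_Limsup[OF sequentially_bot ereal_lim]
    by (auto simp: limI convergentI)
qed

end
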